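(* Let $m\ge 0$ and let $\rho$ be a partition of $m$. Let $C_{m,\rho}\in\mathbb C(t)$ be the coefficients defined by the expansion $$e_m(x)=\sum_{\rho\vdash m}C_{m,\rho}\,q_\rho(x;t)$$ of the elementary symmetric function $e_m$ in the basis $\{q_\rho(x;t)\}_{\rho\vdash m}$. Then $$ C_{m,\rho}=(-1)^m\sum_{\mathfrak b\in\mathscr{B}_{\rho}}\prod_{i=1}^{\ell(\mathfrak b)}\frac{1}{t^{r_i(\mathfrak b)}-1}, $$ where $\mathscr B_\rho$ denotes the set of brick tabloids of type $\rho$.
   Context: Work in the ring of symmetric functions in variables $x_1,x_2,\ldots$ over $\mathbb C(t)$, with power sums $p_r=\sum_i x_i^r$. The generalized complete symmetric functions $q_n(x;t)$ are defined by $$\exp\left(\sum_{n\ge1}\frac{1-t^n}{n}p_nz^n\right)=\sum_{n\ge0}q_n(x;t)z^n,$$ and $q_\rho(x;t)=q_{\rho_1}(x;t)q_{\rho_2}(x;t)\cdots$ for a partition $\rho$. The $q_\rho(x;t)$, with $\rho$ ranging over all partitions, form a $\mathbb C(t)$-basis of the ring of symmetric functions over $\mathbb C(t)$; $q_\rho$ is homogeneous of degree $|\rho|$. A brick tabloid of $m$ is a row of $m$ boxes tiled by consecutive bricks, i.e. an ordered sequence $\mathfrak b=(b_1,\ldots,b_k)$ of positive integers with $\sum_i b_i=m$; $\ell(\mathfrak b)=k$ is the number of bricks and $r_i(\mathfrak b)=b_1+\cdots+b_i$. The only brick tabloid of $0$ is $\varnothing$, with $\ell(\varnothing)=0$ (empty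 product equal to $1$). A brick tabloid is of type $\rho$ if rearranging its brick lengths in weakly decreasing order gives the partition $\rho$. *)

theory Defs
  imports
    Complex_Main
    "HOL-Library.Poly_Mapping"
    "HOL-Computational_Algebra.Formal_Power_Series"
    "HOL-Computational_Algebra.Polynomial"
    "HOL-Computational_Algebra.Fraction_Field"
begin

section \<open>The ring of symmetric functions\<close>

text \<open>
  A monomial in infinitely many variables is given by its finitely supported exponent vector
  \<open>\<alpha> :: nat \<Rightarrow>\<^sub>0 nat\<close>; the variables are indexed from 0, so the variable \<open>x\<^sub>i\<close> of the literature
  has index \<open>i - 1\<close>. A symmetric function is a formal power series (a coefficient for each
  monomial) of bounded total degree that is invariant under all permutations of the variables.
\<close>

definition mdeg :: "(nat \<Rightarrow>\<^sub>0 nat) \<Rightarrow> nat" where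
  "mdeg \<alpha> = (\<Sum>i\<in>Poly_Mapping.keys \<alpha>. Poly_Mapping.lookup \<alpha> i)"

definition decomps :: "(nat \<Rightarrow>\<^sub>0 nat) \<Rightarrow> ((nat \<Rightarrow>\<^sub>0 nat) \<times> (nat \<Rightarrow>\<^sub>0 nat)) set" where
  "decomps \<alpha> = {(\<beta>, \<gamma>). \<beta> + \<gamma> = \<alpha>}"

typedef (overloaded) 'a symfun =
  "{f :: (nat \<Rightarrow>\<^sub>0 nat) \<Rightarrow> 'a::zero.
      (\<exists>d. \<forall>\<alpha>. f \<alpha> \<noteq> 0 \<longrightarrow> mdeg \<alpha> \<le> d) \<and>
      (\<forall>\<pi> \<alpha>. bij \<pi> \<longrightarrow> f (Poly_Mapping.map_key \<pi> \<alpha>) = f \<alpha>)}"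
  morphisms mcoeff Abs_symfun
  by (rule exI[of _ "\<lambda>_. 0"]) simp

setup_lifting type_definition_symfun

lemma symfun_eqI: "(\<And>\<alpha>. mcoeff f \<alpha> = mcoeff g \<alpha>) \<Longrightarrow> f = g"
  by (simp add: mcoeff_inject[symmetric] fun_eq_iff)

lemma mdeg_superset:
  assumes "finite A" "Poly_Mapping.keys \<alpha> \<subseteq> A"
  shows "mdeg \<alpha> = (\<Sum>i\<in>A. Poly_Mapping.lookup \<alpha> i)"
  unfolding mdeg_def using assms by (intro sum.mono_neutral_left) (auto simp: in_keys_iff)

lemma mdeg_add: "mdeg (\<alpha> + \<beta>) = mdeg \<alpha> + mdeg \<beta>"
proof -
  let ?A = "Poly_Mapping.keys \<alpha> \<union> Poly_Mapping.keys \<beta>"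
  have "mdeg (\<alpha> + \<beta>) = (\<Sum>i\<in>?A. Poly_Mapping.lookup (\<alpha> + \<beta>) i)"
    by (rule mdeg_superset) (auto dest: subsetD[OF Poly_Mapping.keys_add])
  then show ?thesis
    by (simp add: lookup_add sum.distrib mdeg_superset[of ?A])
qed

lemma lookup_map_key_bij: "bij \<pi> \<Longrightarrow> Poly_Mapping.lookup (Poly_Mapping.map_key \<pi> \<alpha>) i = Poly_Mapping.lookup \<alpha> (\<pi> i)"
  by (simp add: map_key.rep_eq bij_is_inj)

lemma map_key_add_bij:
  fixes \<alpha> \<beta> :: "nat \<Rightarrow>\<^sub>0 nat"
  shows "bij \<pi> \<Longrightarrow> Poly_Mapping.map_key \<pi> (\<alpha> + \<beta>)
    = Poly_Mapping.map_key \<pi> \<alpha> + Poly_Mapping.map_key \<pi> \<beta>"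
  by (rule poly_mapping_eqI) (simp add: lookup_map_key_bij lookup_add)

lemma map_key_inv_bij:
  fixes \<alpha> :: "nat \<Rightarrow>\<^sub>0 nat"
  assumes "bij \<pi>"
  shows "Poly_Mapping.map_key \<pi> (Poly_Mapping.map_key (inv \<pi>) \<alpha>) = \<alpha>"
    and "Poly_Mapping.map_key (inv \<pi>) (Poly_Mapping.map_key \<pi> \<alpha>) = \<alpha>"
  using assms
  by (auto intro!: poly_mapping_eqI
      simp: lookup_map_key_bij bij_imp_bij_inv bij_is_inj bij_is_surj surj_f_inv_f)

lemma keys_map_key_bij:
  fixes \<alpha> :: "nat \<Rightarrow>\<^sub>0 nat"
  shows "bij \<pi> \<Longrightarrow> Poly_Mapping.keys (Poly_Mapping.map_key \<pi> \<alpha>) = \<pi> -` Poly_Mapping.keys \<alpha>"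
  by (auto simp: in_keys_iff lookup_map_key_bij)

lemma mdeg_map_key:
  assumes "bij \<pi>"
  shows "mdeg (Poly_Mapping.map_key \<pi> \<alpha>) = mdeg \<alpha>"
proof -
  have "bij_betw \<pi> (\<pi> -` Poly_Mapping.keys \<alpha>) (Poly_Mapping.keys \<alpha>)"
    using assms
    by (metis bij_betw_def bij_betw_subset bij_is_surj subset_UNIV surj_image_vimage_eq)
  then show ?thesis
    unfolding mdeg_def keys_map_key_bij[OF assms] lookup_map_key_bij[OF assms]
    by (rule sum.reindex_bij_betw)
qed

lemma finite_decomps: "finite (decomps \<alpha>)"
proof -
  let ?g = "\<lambda>(\<beta>, \<gamma>). restrict (Poly_Mapping.lookup \<beta>) (Poly_Mapping.keys \<alpha>)"
  have sub: "Poly_Mapping.keys \<beta> \<subseteq> Poly_Mapping.keys \<alpha>" if "\<beta> + \<gamma> = \<alpha>" for \<beta> \<gamma> :: "nat \<Rightarrow>\<^sub>0 nat"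
    using that by (auto simp: in_keys_iff lookup_add)
  have "?g ` decomps \<alpha> \<subseteq> (\<Pi>\<^sub>E i\<in>Poly_Mapping.keys \<alpha>. {..Poly_Mapping.lookup \<alpha> i})"
    by (auto simp: decomps_def lookup_add)
  then have "finite (?g ` decomps \<alpha>)"
    by (rule finite_subset) (auto intro!: finite_PiE)
  moreover have "inj_on ?g (decomps \<alpha>)"
  proof (rule inj_onI, clarify)
    fix \<beta> \<gamma> \<beta>' \<gamma>'
    assume *: "(\<beta>, \<gamma>) \<in> decomps \<alpha>" "(\<beta>', \<gamma>') \<in> decomps \<alpha>"
      "restrict (Poly_Mapping.lookup \<beta>) (Poly_Mapping.keys \<alpha>) = restrict (Poly_Mapping.lookup \<beta>') (Poly_Mapping.keys \<alpha>)"
    have "\<beta> = \<beta>'"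
    proof (rule poly_mapping_eqI)
      fix i
      show "Poly_Mapping.lookup \<beta> i = Poly_Mapping.lookup \<beta>' i"
      proof (cases "i \<in> Poly_Mapping.keys \<alpha>")
        case True
        then show ?thesis using fun_cong[OF *(3), of i] by simp
      next
        case False
        then have "i \<notin> Poly_Mapping.keys \<beta>" "i \<notin> Poly_Mapping.keys \<beta>'"
          using *(1,2) sub[of \<beta> \<gamma>] sub[of \<beta>' \<gamma>'] unfolding decomps_def by blast+
        then show ?thesis by (simp add: in_keys_iff)
      qed
    qed
    then show "\<beta> = \<beta>' \<and> \<gamma> = \<gamma>'" using *(1,2) by (auto simp: decomps_def)
  qed
  ultimately show ?thesis by (rule finite_imageD)
qed

instantiation symfun :: (comm_ring_1) comm_ring_1
begin

lift_definition zero_symfun :: "'a symfun" is "\<lambda>_. 0" by simp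

lift_definition one_symfun :: "'a symfun" is "\<lambda>\<alpha>. if \<alpha> = 0 then 1 else 0"
proof (intro CollectI conjI allI impI)
  show "\<exists>d. \<forall>\<alpha>. (if \<alpha> = 0 then 1 else 0) \<noteq> (0::'a) \<longrightarrow> mdeg \<alpha> \<le> d"
    by (rule exI[of _ 0]) (auto simp: mdeg_def)
next
  fix \<pi> :: "nat \<Rightarrow> nat" and \<alpha> :: "nat \<Rightarrow>\<^sub>0 nat"
  assume "bij \<pi>"
  moreover from this have "Poly_Mapping.map_key \<pi> \<alpha> = 0 \<longleftrightarrow> \<alpha> = 0"
    by (metis map_key_inv_bij(1) map_key_inv_bij(2) lookup_map_key_bij lookup_zero poly_mapping_eqI)
  ultimately show "(if Poly_Mapping.map_key \<pi> \<alpha> = 0 then 1 else 0) = (if \<alpha> = 0 then 1 else (0::'a))"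
    by simp
qed

lift_definition uminus_symfun :: "'a symfun \<Rightarrow> 'a symfun" is "\<lambda>f \<alpha>. - f \<alpha>" by simp

lift_definition plus_symfun :: "'a symfun \<Rightarrow> 'a symfun \<Rightarrow> 'a symfun" is "\<lambda>f g \<alpha>. f \<alpha> + g \<alpha>"
proof (intro CollectI conjI allI impI; clarsimp)
  fix f g :: "(nat \<Rightarrow>\<^sub>0 nat) \<Rightarrow> 'a" and d e
  assume "\<forall>\<alpha>. f \<alpha> \<noteq> 0 \<longrightarrow> mdeg \<alpha> \<le> d" "\<forall>\<alpha>. g \<alpha> \<noteq> 0 \<longrightarrow> mdeg \<alpha> \<le> e"
  then show "\<exists>d. \<forall>\<alpha>. f \<alpha> + g \<alpha> \<noteq> 0 \<longrightarrow> mdeg \<alpha> \<le> d"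
    by (intro exI[of _ "max d e"]) (metis add.right_neutral max.coboundedI1 max.coboundedI2)
qed

lift_definition minus_symfun :: "'a symfun \<Rightarrow> 'a symfun \<Rightarrow> 'a symfun" is "\<lambda>f g \<alpha>. f \<alpha> - g \<alpha>"
proof (intro CollectI conjI allI impI; clarsimp)
  fix f g :: "(nat \<Rightarrow>\<^sub>0 nat) \<Rightarrow> 'a" and d e
  assume "\<forall>\<alpha>. f \<alpha> \<noteq> 0 \<longrightarrow> mdeg \<alpha> \<le> d" "\<forall>\<alpha>. g \<alpha> \<noteq> 0 \<longrightarrow> mdeg \<alpha> \<le> e"
  then show "\<exists>d. \<forall>\<alpha>. f \<alpha> \<noteq> g \<alpha> \<longrightarrow> mdeg \<alpha> \<le> d"
    by (intro exI[of _ "max d e"]) (metis max.coboundedI1 max.coboundedI2)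
qed

lift_definition times_symfun :: "'a symfun \<Rightarrow> 'a symfun \<Rightarrow> 'a symfun" is
  "\<lambda>f g \<alpha>. \<Sum>(\<beta>, \<gamma>)\<in>decomps \<alpha>. f \<beta> * g \<gamma>"
proof (intro CollectI conjI allI impI)
  fix f g :: "(nat \<Rightarrow>\<^sub>0 nat) \<Rightarrow> 'a"
  assume "(\<exists>d. \<forall>\<alpha>. f \<alpha> \<noteq> 0 \<longrightarrow> mdeg \<alpha> \<le> d) \<and>
         (\<forall>\<pi> \<alpha>. bij \<pi> \<longrightarrow> f (Poly_Mapping.map_key \<pi> \<alpha>) = f \<alpha>)"
    and "(\<exists>d. \<forall>\<alpha>. g \<alpha> \<noteq> 0 \<longrightarrow> mdeg \<alpha> \<le> d) \<and>
         (\<forall>\<pi> \<alpha>. bij \<pi> \<longrightarrow> g (Poly_Mapping.map_key \<pi> \<alpha>) = g \<alpha>)"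
  then obtain d e where d: "\<And>\<alpha>. f \<alpha> \<noteq> 0 \<Longrightarrow> mdeg \<alpha> \<le> d" and e: "\<And>\<alpha>. g \<alpha> \<noteq> 0 \<Longrightarrow> mdeg \<alpha> \<le> e"
    and f: "\<And>\<pi> \<alpha>. bij \<pi> \<Longrightarrow> f (Poly_Mapping.map_key \<pi> \<alpha>) = f \<alpha>"
    and g: "\<And>\<pi> \<alpha>. bij \<pi> \<Longrightarrow> g (Poly_Mapping.map_key \<pi> \<alpha>) = g \<alpha>"
    by auto
  show "\<exists>d. \<forall>\<alpha>. (\<Sum>(\<beta>, \<gamma>)\<in>decomps \<alpha>. f \<beta> * g \<gamma>) \<noteq> 0 \<longrightarrow> mdeg \<alpha> \<le> d"
  proof (intro exI[of _ "d + e"] allI impI)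
    fix \<alpha>
    assume "(\<Sum>(\<beta>, \<gamma>)\<in>decomps \<alpha>. f \<beta> * g \<gamma>) \<noteq> 0"
    then obtain \<beta> \<gamma> where "(\<beta>, \<gamma>) \<in> decomps \<alpha>" "f \<beta> * g \<gamma> \<noteq> 0"
      using sum.not_neutral_contains_not_neutral[of "\<lambda>(\<beta>, \<gamma>). f \<beta> * g \<gamma>" "decomps \<alpha>"] by auto
    then have "\<alpha> = \<beta> + \<gamma>" "f \<beta> \<noteq> 0" "g \<gamma> \<noteq> 0"
      by (auto simp: decomps_def)
    then show "mdeg \<alpha> \<le> d + e" using d[of \<beta>] e[of \<gamma>] by (simp add: mdeg_add)
  qed
  fix \<pi> :: "nat \<Rightarrow> nat" and \<alpha> :: "nat \<Rightarrow>\<^sub>0 nat"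
  assume \<pi>: "bij \<pi>"
  let ?k = "\<lambda>\<pi>. map_prod (Poly_Mapping.map_key \<pi>) (Poly_Mapping.map_key \<pi>)"
  have "(\<Sum>(\<beta>, \<gamma>)\<in>decomps \<alpha>. f \<beta> * g \<gamma>)
      = (\<Sum>(\<beta>, \<gamma>)\<in>decomps (Poly_Mapping.map_key \<pi> \<alpha>). f \<beta> * g \<gamma>)"
    by (rule sum.reindex_bij_witness[where i = "?k (inv \<pi>)" and j = "?k \<pi>"])
      (auto simp: decomps_def map_key_inv_bij[OF \<pi>] map_key_add_bij[OF \<pi>, symmetric]
        map_key_add_bij[OF bij_imp_bij_inv[OF \<pi>], symmetric] f[OF \<pi>] g[OF \<pi>])
  then show "(\<Sum>(\<beta>, \<gamma>)\<in>decomps (Poly_Mapping.map_key \<pi> \<alpha>). f \<beta> * g \<gamma>)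
      = (\<Sum>(\<beta>, \<gamma>)\<in>decomps \<alpha>. f \<beta> * g \<gamma>)" by simp
qed

instance
proof
  fix a b c :: "'a symfun"
  show "a * b * c = a * (b * c)"
  proof (rule symfun_eqI)
    fix \<alpha>
    have "mcoeff (a * b * c) \<alpha> = (\<Sum>(\<beta>, \<gamma>)\<in>decomps \<alpha>. \<Sum>(\<delta>, \<epsilon>)\<in>decomps \<beta>.
        mcoeff a \<delta> * mcoeff b \<epsilon> * mcoeff c \<gamma>)"
      by (simp add: times_symfun.rep_eq sum_distrib_right case_prod_unfold)
    also have "\<dots> = (\<Sum>((\<beta>, \<gamma>), (\<delta>, \<epsilon>))\<in>Sigma (decomps \<alpha>) (\<lambda>(\<beta>, \<gamma>). decomps \<beta>).
        mcoeff a \<delta> * mcoeff b \<epsilon> * mcoeff c \<gamma>)"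
      by (subst sum.Sigma[symmetric]) (auto simp: finite_decomps case_prod_unfold)
    also have "\<dots> = (\<Sum>((\<beta>, \<gamma>), (\<delta>, \<epsilon>))\<in>Sigma (decomps \<alpha>) (\<lambda>(\<beta>, \<gamma>). decomps \<gamma>).
        mcoeff a \<beta> * (mcoeff b \<delta> * mcoeff c \<epsilon>))"
      by (rule sum.reindex_bij_witness
          [where i = "\<lambda>((\<beta>, \<gamma>), (\<delta>, \<epsilon>)). ((\<beta> + \<delta>, \<epsilon>), (\<beta>, \<delta>))"
             and j = "\<lambda>((\<beta>, \<gamma>), (\<delta>, \<epsilon>)). ((\<delta>, \<epsilon> + \<gamma>), (\<epsilon>, \<gamma>))"])
        (auto simp: decomps_def ac_simps)
    also have "\<dots> = (\<Sum>(\<beta>, \<gamma>)\<in>decomps \<alpha>. \<Sum>(\<delta>, \<epsilon>)\<in>decomps \<gamma>.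
        mcoeff a \<beta> * (mcoeff b \<delta> * mcoeff c \<epsilon>))"
      by (subst sum.Sigma[symmetric]) (auto simp: finite_decomps case_prod_unfold)
    also have "\<dots> = mcoeff (a * (b * c)) \<alpha>"
      by (simp add: times_symfun.rep_eq sum_distrib_left case_prod_unfold)
    finally show "mcoeff (a * b * c) \<alpha> = mcoeff (a * (b * c)) \<alpha>" .
  qed
  show "a * b = b * a"
  proof (rule symfun_eqI)
    fix \<alpha>
    show "mcoeff (a * b) \<alpha> = mcoeff (b * a) \<alpha>"
      unfolding times_symfun.rep_eq
      by (rule sum.reindex_bij_witness[where i = prod.swap and j = prod.swap])
        (auto simp: decomps_def ac_simps)
  qed
  show "1 * a = a"
  proof (rule symfun_eqI)
    fix \<alpha>
    have "mcoeff (1 * a) \<alpha> = (\<Sum>(\<beta>, \<gamma>)\<in>{(0, \<alpha>)}. mcoeff 1 \<beta> * mcoeff a \<gamma>)"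
      unfolding times_symfun.rep_eq
      by (rule sum.mono_neutral_right)
        (auto simp: finite_decomps, auto simp: decomps_def one_symfun.rep_eq split: if_splits)
    then show "mcoeff (1 * a) \<alpha> = mcoeff a \<alpha>"
      by (simp add: one_symfun.rep_eq)
  qed
  show "(a + b) * c = a * c + b * c"
    by (rule symfun_eqI)
      (simp add: times_symfun.rep_eq plus_symfun.rep_eq case_prod_unfold distrib_right sum.distrib)
  show "a + b + c = a + (b + c)" "a + b = b + a" "0 + a = a" "- a + a = 0" "a - b = a + - b"
    by (rule symfun_eqI,
        simp add: plus_symfun.rep_eq zero_symfun.rep_eq uminus_symfun.rep_eq
          minus_symfun.rep_eq algebra_simps)+
  have "mcoeff (0::'a symfun) 0 \<noteq> mcoeff 1 0"
    by (simp add: zero_symfun.rep_eq one_symfun.rep_eq)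
  then show "(0::'a symfun) \<noteq> 1" by metis
qed

end

lift_definition scale :: "'a::comm_ring_1 \<Rightarrow> 'a symfun \<Rightarrow> 'a symfun"  (infixr \<open>\<odot>\<close> 75)
  is "\<lambda>c f \<alpha>. c * f \<alpha>"
  by (auto; metis mult_zero_right)

text \<open>
  Only \<open>power_sum r\<close> with \<open>r > 0\<close> is a power sum; \<open>power_sum 0\<close> is 1 and is never used.
\<close>

lift_definition power_sum :: "nat \<Rightarrow> 'a::comm_ring_1 symfun" is
  "\<lambda>r \<alpha>. if \<exists>i. \<alpha> = Poly_Mapping.single i r then 1 else 0"
proof (intro CollectI conjI allI impI)
  fix r
  show "\<exists>d. \<forall>\<alpha>. (if \<exists>i. \<alpha> = Poly_Mapping.single i r then 1 else 0) \<noteq> (0::'a) \<longrightarrow> mdeg \<alpha> \<le> d"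
    by (rule exI[of _ r]) (auto simp: mdeg_def)
  fix \<pi> :: "nat \<Rightarrow> nat" and \<alpha> :: "nat \<Rightarrow>\<^sub>0 nat"
  assume \<pi>: "bij \<pi>"
  have s: "Poly_Mapping.map_key \<sigma> (Poly_Mapping.single i r) = Poly_Mapping.single (inv \<sigma> i) r"
    if "bij \<sigma>" for \<sigma> :: "nat \<Rightarrow> nat" and i
    using that
    by (intro poly_mapping_eqI)
      (auto simp: lookup_map_key_bij lookup_single when_def bij_is_inj bij_is_surj surj_f_inv_f)
  have "(\<exists>i. Poly_Mapping.map_key \<pi> \<alpha> = Poly_Mapping.single i r)
      \<longleftrightarrow> (\<exists>i. \<alpha> = Poly_Mapping.single i r)"
    by (metis map_key_inv_bij(2)[OF \<pi>] s[OF \<pi>] s[OF bij_imp_bij_inv[OF \<pi>]])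
  then show "(if \<exists>i. Poly_Mapping.map_key \<pi> \<alpha> = Poly_Mapping.single i r then 1 else 0)
      = (if \<exists>i. \<alpha> = Poly_Mapping.single i r then 1 else (0::'a))" by simp
qed

lift_definition elementary :: "nat \<Rightarrow> 'a::comm_ring_1 symfun" is
  "\<lambda>m \<alpha>. if mdeg \<alpha> = m \<and> (\<forall>i. Poly_Mapping.lookup \<alpha> i \<le> 1) then 1 else 0"
proof (intro CollectI conjI allI impI)
  fix m
  show "\<exists>d. \<forall>\<alpha>. (if mdeg \<alpha> = m \<and> (\<forall>i. Poly_Mapping.lookup \<alpha> i \<le> 1) then 1 else 0) \<noteq> (0::'a) \<longrightarrow> mdeg \<alpha> \<le> d"
    by (rule exI[of _ m]) auto
  fix \<pi> :: "nat \<Rightarrow> nat" and \<alpha> :: "nat \<Rightarrow>\<^sub>0 nat"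
  assume \<pi>: "bij \<pi>"
  have "(\<forall>i. Poly_Mapping.lookup \<alpha> (\<pi> i) \<le> 1) \<longleftrightarrow> (\<forall>i. Poly_Mapping.lookup \<alpha> i \<le> 1)"
    using \<pi> by (metis bij_pointE)
  then show "(if mdeg (Poly_Mapping.map_key \<pi> \<alpha>) = m \<and>
        (\<forall>i. Poly_Mapping.lookup (Poly_Mapping.map_key \<pi> \<alpha>) i \<le> 1) then 1 else 0)
      = (if mdeg \<alpha> = m \<and> (\<forall>i. Poly_Mapping.lookup \<alpha> i \<le> 1) then 1 else (0::'a))"
    by (simp add: mdeg_map_key[OF \<pi>] lookup_map_key_bij[OF \<pi>])
qed


section \<open>Generalized complete symmetric functions over \<open>\<complex>(t)\<close>\<close>

type_synonym ratfun = "complex poly fract"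

definition t_var :: ratfun where
  "t_var = Fract [:0, 1:] 1"

text \<open>
  The exponential \<open>\<Sum>k. F ^ k / k!\<close> of a power series \<open>F\<close> in \<open>z\<close> with zero constant coefficient. The
  library's \<open>fps_exp\<close> is not available over the ring of symmetric functions, as it needs the
  coefficients to form a field.
\<close>

definition exp_fps :: "'a::field symfun fps \<Rightarrow> 'a symfun fps" where
  "exp_fps F = Abs_fps (\<lambda>k. (1 / of_nat (fact k)) \<odot> 1) oo F"

text \<open>
  \<open>q\<^sub>n(x; t)\<close>, the coefficient of \<open>z\<^sup>n\<close> in \<open>exp (\<Sum>n\<ge>1. (1 - t\<^sup>n) / n * p\<^sub>n * z\<^sup>n)\<close>.
\<close>

definition gen_complete :: "nat \<Rightarrow> ratfun symfun" where
  "gen_complete n = fps_nth (exp_fps (Abs_fps (\<lambda>n. if n = 0 then 0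
            else ((1 - t_var ^ n) / of_nat n) \<odot> power_sum n))) n"

definition gen_complete_part :: "nat list \<Rightarrow> ratfun symfun" where
  "gen_complete_part \<rho> = prod_list (map gen_complete \<rho>)"

text \<open>Partitions of \<open>m\<close>, as weakly decreasing lists of positive integers.\<close>

definition partitions :: "nat \<Rightarrow> nat list set" where
  "partitions m = {\<rho>. sorted_wrt (\<ge>) \<rho> \<and> (\<forall>b\<in>set \<rho>. 0 < b) \<and> sum_list \<rho> = m}"

text \<open>
  The coefficients of \<open>elementary m\<close> in the basis \<open>gen_complete_part \<rho>\<close>, \<open>\<rho> \<in> partitions m\<close>.
  The family is extended by 0 outside \<open>partitions m\<close>, so that it is unique as a function on all
  lists; its existence and uniqueness are the basis property of the \<open>gen_complete_part \<rho>\<close>.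
\<close>

definition e_to_q_coeff :: "nat \<Rightarrow> nat list \<Rightarrow> ratfun" where
  "e_to_q_coeff m = (THE c. (\<forall>\<rho>. \<rho> \<notin> partitions m \<longrightarrow> c \<rho> = 0) \<and>
                 elementary m = (\<Sum>\<rho>\<in>partitions m. c \<rho> \<odot> gen_complete_part \<rho>))"


section \<open>Brick tabloids\<close>

text \<open>
  Brick tabloids of type \<open>\<rho>\<close>, as lists of brick lengths; \<open>brick_end \<bb> i\<close> is \<open>r\<^sub>i(\<bb>) = b\<^sub>1 + \<dots> + b\<^sub>i\<close>.
\<close>

definition brick_tabloids :: "nat list \<Rightarrow> nat list set" where
  "brick_tabloids \<rho> = {\<bb>. (\<forall>b\<in>set \<bb>. 0 < b) \<and> rev (sort \<bb>) = \<rho>}"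

definition brick_end :: "nat list \<Rightarrow> nat \<Rightarrow> nat" where
  "brick_end \<bb> i = sum_list (take i \<bb>)"

lemma finite_partitions: "finite (partitions m)"
proof (rule finite_subset)
  show "partitions m \<subseteq> {xs. set xs \<subseteq> {..m} \<and> length xs \<le> m}"
  proof
    fix \<rho> assume \<rho>: "\<rho> \<in> partitions m"
    have "length xs \<le> sum_list xs" if "\<forall>b\<in>set xs. 0 < b" for xs :: "nat list"
      using that by (induction xs) auto
    then show "\<rho> \<in> {xs. set xs \<subseteq> {..m} \<and> length xs \<le> m}"
      using \<rho> by (auto simp: partitions_def member_le_sum_list)
  qed
  show "finite {xs. set xs \<subseteq> {..m} \<and> length xs \<le> m}"
    by (rule finite_lists_length_le) simp
qed

lemma finite_brick_tabloids: "finite (brick_tabloids \<rho>)"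
proof (rule finite_subset)
  show "brick_tabloids \<rho> \<subseteq> {xs. set xs \<subseteq> set \<rho> \<and> length xs \<le> length \<rho>}"
    by (auto simp: brick_tabloids_def)
  show "finite {xs. set xs \<subseteq> set \<rho> \<and> length xs \<le> length \<rho>}"
    by (rule finite_lists_length_le) simp
qed

end

theory Submission
  imports Defs
begin

text \<open>
  Let \<open>A(z) = \<Sum>n. (-1)\<^sup>n e\<^sub>n z\<^sup>n\<close> and \<open>Q(z) = \<Sum>n. q\<^sub>n z\<^sup>n\<close>. Newton's identity and the logarithmic derivative
  of \<open>Q\<close> show that \<open>A(t z)\<close> and \<open>Q(z) A(z)\<close> satisfy the same first-order linear differential equation,
  hence they agree. Comparing coefficients, \<open>\<epsilon>\<^sub>m = (-1)\<^sup>m e\<^sub>m\<close> satisfies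
  \<open>(t\<^sup>m - 1) \<epsilon>\<^sub>m = \<Sum>j\<ge>1. q\<^sub>j \<epsilon>\<^sub>m\<^sub>-\<^sub>j\<close>; unfolding this recursion adds one brick at a time, the last
  brick having length \<open>j\<close>.

  For the uniqueness of the expansion, the products \<open>p\<^sub>\<rho>\<close> of power sums with \<open>\<rho> \<turnstile> m\<close> are linearly
  independent by triangularity and lie in the span of the equally many \<open>q\<^sub>\<rho>\<close>, so the \<open>q\<^sub>\<rho>\<close> are linearly
  independent as well.
\<close>

section \<open>Symmetric functions as an algebra\<close>

text \<open>The exponential series and the uniqueness of solutions below divide by positive
  integers; this makes \<open>ratfun\<close> a field of characteristic zero.\<close>

instance fract :: ("{idom, ring_char_0}") field_char_0
proof
  show "inj (of_nat :: nat \<Rightarrow> 'a fract)"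
    by (rule injI) (simp add: of_nat_fract eq_fract)
qed

lemmas mcoeff_simps = zero_symfun.rep_eq one_symfun.rep_eq uminus_symfun.rep_eq
  plus_symfun.rep_eq minus_symfun.rep_eq scale.rep_eq

interpretation symfun_vs: vector_space "scale :: 'a::field \<Rightarrow> _"
  by unfold_locales (auto intro!: symfun_eqI simp: mcoeff_simps algebra_simps)

lemma mcoeff_sum: "mcoeff (\<Sum>i\<in>I. f i) \<alpha> = (\<Sum>i\<in>I. mcoeff (f i) \<alpha>)"
  by (induction I rule: infinite_finite_induct) (auto simp: mcoeff_simps)

lemma scale_mult_left: "(c \<odot> f) * g = c \<odot> (f * g)"
  by (rule symfun_eqI)
    (simp add: times_symfun.rep_eq scale.rep_eq sum_distrib_left case_prod_unfold mult.assoc)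

lemma scale_mult_right: "f * (c \<odot> g) = c \<odot> (f * g)"
  by (metis mult.commute scale_mult_left)

lemma of_nat_mult_symfun: "of_nat n * f = of_nat n \<odot> f"
  for f :: "'a::field symfun"
  by (induction n) (simp_all add: symfun_vs.scale_left_distrib algebra_simps)

lemma neg_one_power_mult_symfun: "(-1) ^ n * f = (-1) ^ n \<odot> f"
  for f :: "'a::field symfun"
  by (induction n) (simp_all add: scale_mult_left)

text \<open>A dimension count: the independent family \<open>f\<close> forces the span of the
  \<open>g i\<close> to have dimension at least \<open>card I\<close>, which leaves no room for a
  relation among the \<open>g i\<close>. Indexed families, rather than sets, also rule out
  coincidences \<open>g i = g j\<close>.\<close>

lemma (in vector_space) scalars_zero_if_independent_in_span:
  fixes f g :: "'i \<Rightarrow> 'b"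
  assumes "finite I"
    and f: "\<And>c. (\<Sum>i\<in>I. c i *s f i) = 0 \<Longrightarrow> \<forall>i\<in>I. c i = 0"
    and sub: "f ` I \<subseteq> span (g ` I)"
    and g0: "(\<Sum>i\<in>I. c i *s g i) = 0" and "i \<in> I"
  shows "c i = 0"
proof -
  have inj_f: "inj_on f I"
  proof (rule inj_onI, rule ccontr)
    fix i j assume ij: "i \<in> I" "j \<in> I" "f i = f j" "i \<noteq> j"
    let ?c = "\<lambda>k. if k = i then 1 else if k = j then -1 else (0::'a)"
    have "(\<Sum>k\<in>I. ?c k *s f k) = (\<Sum>k\<in>{i, j}. ?c k *s f k)"
      using ij \<open>finite I\<close> by (intro sum.mono_neutral_right) auto
    also have "\<dots> = 0" using ij by simp
    finally have "(\<Sum>k\<in>I. ?c k *s f k) = 0" .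
    from f[OF this] ij(1) show False by (auto dest: bspec[of _ _ i])
  qed
  have indep_f: "independent (f ` I)"
  proof (rule independent_if_scalars_zero)
    fix u x assume "(\<Sum>x\<in>f ` I. u x *s x) = 0" "x \<in> f ` I"
    then show "u x = 0" using f[of "u \<circ> f"] by (auto simp: sum.reindex[OF inj_f])
  qed (use \<open>finite I\<close> in simp)
  \<comment> \<open>The exchange lemma bounds every finite set whose span contains all
    \<open>g i\<close>. For the image of \<open>g\<close> this yields injectivity; for that image
    without \<open>g k\<close> it yields independence.\<close>
  have bound: "card I \<le> card B" if "finite B" "g ` I \<subseteq> span B" for B
  proof -
    have "f ` I \<subseteq> span B" using sub that(2) span_minimal[OF that(2) subspace_span] by blast
    then show ?thesis
      using independent_span_bound[OF that(1) indep_f] card_image[OF inj_f] by simp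
  qed
  have inj_g: "inj_on g I"
    using bound[of "g ` I"] \<open>finite I\<close> card_image_le[of I g] span_superset[of "g ` I"]
    by (intro eq_card_imp_inj_on) auto
  have "independent (g ` I)"
    unfolding dependent_def
  proof clarify
    fix k assume k: "k \<in> I" "g k \<in> span (g ` I - {g k})"
    have "g ` I \<subseteq> span (g ` I - {g k})" 
    proof
      fix x assume "x \<in> g ` I"
      then show "x \<in> span (g ` I - {g k})" using k(2) by (cases "x = g k") (auto intro: span_base)
    qed
    from bound[OF _ this] have "card I \<le> card (g ` I - {g k})" using \<open>finite I\<close> by simp
    also have "\<dots> < card (g ` I)" using \<open>finite I\<close> k(1) by (intro psubset_card_mono) auto
    also have "\<dots> \<le> card I" using \<open>finite I\<close> by (rule card_image_le)
    finally show False by simp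
  qed
  moreover have "(\<Sum>v\<in>g ` I. c (the_inv_into I g v) *s v) = 0"
    using g0 by (simp add: sum.reindex[OF inj_g] the_inv_into_f_f[OF inj_g] cong: sum.cong)
  ultimately have "c (the_inv_into I g (g i)) = 0"
    using \<open>finite I\<close> \<open>i \<in> I\<close> by (intro independentD[of "g ` I" "g ` I" "\<lambda>v. c (the_inv_into I g v)"]) auto
  then show ?thesis using the_inv_into_f_f[OF inj_g \<open>i \<in> I\<close>] by simp
qed

section \<open>Multiplication by power sums and Newton's identity\<close>

lemma finite_le_lookup: "0 < n \<Longrightarrow> finite {i. n \<le> Poly_Mapping.lookup \<alpha> i}"
  for \<alpha> :: "nat \<Rightarrow>\<^sub>0 nat"
  by (rule finite_subset[of _ "Poly_Mapping.keys \<alpha>"]) (auto simp: in_keys_iff)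

lemma single_add_diff:
  "n \<le> Poly_Mapping.lookup \<alpha> i \<Longrightarrow>
    Poly_Mapping.single i n + (\<alpha> - Poly_Mapping.single i n) = \<alpha>"
  for \<alpha> :: "nat \<Rightarrow>\<^sub>0 nat"
  by (rule poly_mapping_eqI) (auto simp: lookup_add lookup_minus lookup_single when_def)

text \<open>Only splittings of \<alpha> whose first part is \<open>Poly_Mapping.single i n\<close>
  contribute. Positivity of \<open>n\<close> makes \<open>i\<close> recoverable from that monomial,
  as its only key.\<close>

lemma mcoeff_power_sum_mult:
  fixes f :: "'a::comm_ring_1 symfun"
  assumes "0 < n"
  shows "mcoeff (power_sum n * f) \<alpha> =
    (\<Sum>i | n \<le> Poly_Mapping.lookup \<alpha> i. mcoeff f (\<alpha> - Poly_Mapping.single i n))"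
proof -
  let ?I = "{i. n \<le> Poly_Mapping.lookup \<alpha> i}"
  let ?h = "\<lambda>i. (Poly_Mapping.single i n, \<alpha> - Poly_Mapping.single i n)"
  have inj: "inj_on ?h ?I"
    using assms by (auto intro!: inj_onI dest!: arg_cong[where f = Poly_Mapping.keys])
  have "mcoeff (power_sum n * f) \<alpha> =
      (\<Sum>(\<beta>, \<gamma>)\<in>?h ` ?I. mcoeff (power_sum n) \<beta> * mcoeff f \<gamma>)"
    unfolding times_symfun.rep_eq
  proof (rule sum.mono_neutral_right)
    show "?h ` ?I \<subseteq> decomps \<alpha>" by (auto simp: decomps_def single_add_diff)
    show "\<forall>x\<in>decomps \<alpha> - ?h ` ?I. (case x of (\<beta>, \<gamma>) \<Rightarrow> mcoeff (power_sum n) \<beta> * mcoeff f \<gamma>) = 0"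
    proof clarify
      fix \<beta> \<gamma> assume *: "(\<beta>, \<gamma>) \<in> decomps \<alpha>" "(\<beta>, \<gamma>) \<notin> ?h ` ?I"
      have "mcoeff (power_sum n) \<beta> = (0 :: 'a)"
      proof (rule ccontr)
        assume "mcoeff (power_sum n) \<beta> \<noteq> (0 :: 'a)"
        then obtain i where "\<beta> = Poly_Mapping.single i n"
          by (auto simp: power_sum.rep_eq split: if_splits)
        with * show False by (auto simp: decomps_def lookup_add image_iff)
      qed
      then show "mcoeff (power_sum n) \<beta> * mcoeff f \<gamma> = 0" by simp
    qed
  qed (rule finite_decomps)
  also have "\<dots> = (\<Sum>i\<in>?I. mcoeff f (\<alpha> - Poly_Mapping.single i n))"
    by (subst sum.reindex[OF inj]) (auto simp: power_sum.rep_eq intro!: sum.cong)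
  finally show ?thesis .
qed

lemma lookup_le_mdeg: "Poly_Mapping.lookup \<alpha> i \<le> mdeg \<alpha>"
  by (cases "i \<in> Poly_Mapping.keys \<alpha>") (auto simp: mdeg_def in_keys_iff intro: member_le_sum)

lemma mdeg_single: "mdeg (Poly_Mapping.single i n) = n"
  by (simp add: mdeg_def)

text \<open>
  A variable with exponent \<open>a\<close> contributes to the power sums \<open>p\<^sub>a\<close> and \<open>p\<^sub>a\<^sub>-\<^sub>1\<close> only; the two
  contributions cancel unless \<open>a = 1\<close>, when \<open>p\<^sub>a\<^sub>-\<^sub>1\<close> is not a power sum.
\<close>

lemma alternating_sum_last_two:
  "(\<Sum>k = 1..a. if a - k \<le> 1 then (-1) ^ (k - 1) else 0) = (if a = 1 then 1 else (0::'a::comm_ring_1))"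
proof (cases "a \<le> 1")
  case True
  then show ?thesis by (cases a) auto
next
  case False
  then obtain b where a: "a = Suc (Suc b)" 
    by (metis One_nat_def le_SucI not0_implies_Suc le0 order_refl)
  have "(\<Sum>k = 1..a. if a - k \<le> 1 then (-1) ^ (k - 1) else 0)
      = (\<Sum>k\<in>{Suc b, Suc (Suc b)}. (-1) ^ (k - 1) :: 'a)"
    unfolding a by (intro sum.mono_neutral_cong_right) auto
  then show ?thesis by (simp add: a)
qed

text \<open>Coefficients at \<alpha> are compared: the right side sums over \<open>k\<close> and
  over the variable from which \<open>power_sum k\<close> takes the exponent \<open>k\<close>.
  Summing over \<open>k\<close> first turns the contribution of each variable into the alternating
  sum above.\<close>

lemma newton_identity:
  fixes n :: nat
  shows "of_nat n * (elementary n :: 'a::field symfun) =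
    (\<Sum>k = 1..n. (-1) ^ (k - 1) * (power_sum k * elementary (n - k)))"
proof (rule symfun_eqI)
  fix \<alpha> :: "nat \<Rightarrow>\<^sub>0 nat"
  let ?l = "Poly_Mapping.lookup \<alpha>"
  let ?s = "\<lambda>i. \<forall>j. j \<noteq> i \<longrightarrow> ?l j \<le> 1"
  \<comment> \<open>\<open>?s i\<close> is the part of squarefreeness that does not depend on
    \<open>k\<close>; the exponent of variable \<open>i\<close> is treated separately.\<close>
  have e: "mcoeff (elementary (n - k) :: 'a symfun) (\<alpha> - Poly_Mapping.single i k) =
      (if mdeg \<alpha> = n \<and> ?s i \<and> ?l i - k \<le> 1 then 1 else 0)"
    if "k \<le> ?l i" "k \<le> n" for i k
  proof -
    have "mdeg \<alpha> = k + mdeg (\<alpha> - Poly_Mapping.single i k)"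
      using mdeg_add[of "Poly_Mapping.single i k" "\<alpha> - Poly_Mapping.single i k"]
      by (simp add: single_add_diff that mdeg_single)
    moreover have "(\<forall>j. Poly_Mapping.lookup (\<alpha> - Poly_Mapping.single i k) j \<le> 1)
        \<longleftrightarrow> ?s i \<and> ?l i - k \<le> 1"
      by (auto simp: lookup_minus lookup_single when_def)
    ultimately show ?thesis using that by (auto simp: elementary.rep_eq)
  qed
  have "mcoeff (\<Sum>k = 1..n. (-1) ^ (k - 1) * (power_sum k * elementary (n - k)) :: 'a symfun) \<alpha> =
      (\<Sum>k = 1..n. \<Sum>i | k \<le> ?l i. (-1) ^ (k - 1) *
        (if mdeg \<alpha> = n \<and> ?s i \<and> ?l i - k \<le> 1 then 1 else 0))"
    by (auto simp: mcoeff_sum neg_one_power_mult_symfun scale.rep_eq mcoeff_power_sum_mult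
        sum_distrib_left e intro!: sum.cong)
  \<comment> \<open>As \<open>k \<ge> 1\<close>, only keys of \<alpha> occur. The sums can be
    swapped once \<open>i\<close> is drawn from a finite set independent of
    \<open>k\<close>.\<close>
  also have "\<dots> = (\<Sum>k = 1..n. \<Sum>i\<in>{i\<in>Poly_Mapping.keys \<alpha>. k \<le> ?l i}. (-1) ^ (k - 1) *
        (if mdeg \<alpha> = n \<and> ?s i \<and> ?l i - k \<le> 1 then 1 else 0))"
    by (intro sum.cong refl) (auto simp: in_keys_iff)
  also have "\<dots> = (\<Sum>i\<in>Poly_Mapping.keys \<alpha>. \<Sum>k\<in>{k\<in>{1..n}. k \<le> ?l i}. (-1) ^ (k - 1) *
        (if mdeg \<alpha> = n \<and> ?s i \<and> ?l i - k \<le> 1 then 1 else 0))"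
    by (rule sum.swap_restrict) auto
  \<comment> \<open>In every nonzero summand the exponent is 1; writing it as
    \<open>of_nat (?l i)\<close> makes the sum over the keys the degree.\<close>
  also have "\<dots> = (\<Sum>i\<in>Poly_Mapping.keys \<alpha>. if mdeg \<alpha> = n \<and> (\<forall>j. ?l j \<le> 1) then of_nat (?l i) else 0)"
  proof (rule sum.cong[OF refl])
    fix i assume i: "i \<in> Poly_Mapping.keys \<alpha>"
    show "(\<Sum>k\<in>{k\<in>{1..n}. k \<le> ?l i}. (-1) ^ (k - 1) *
        (if mdeg \<alpha> = n \<and> ?s i \<and> ?l i - k \<le> 1 then 1 else 0)) =
      (if mdeg \<alpha> = n \<and> (\<forall>j. ?l j \<le> 1) then of_nat (?l i) else (0::'a))"
    proof (cases "mdeg \<alpha> = n \<and> ?s i")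
      case True
      have "{k\<in>{1..n}. k \<le> ?l i} = {1..?l i}"
        using lookup_le_mdeg[of \<alpha> i] True by auto
      then have "(\<Sum>k\<in>{k\<in>{1..n}. k \<le> ?l i}. (-1) ^ (k - 1) *
          (if mdeg \<alpha> = n \<and> ?s i \<and> ?l i - k \<le> 1 then 1 else 0)) =
        (\<Sum>k = 1..?l i. if ?l i - k \<le> 1 then (-1) ^ (k - 1) else (0::'a))"
        using True by (intro sum.cong) auto
      also have "\<dots> = (if ?l i = 1 then 1 else 0)" by (rule alternating_sum_last_two)
      also have "\<dots> = (if mdeg \<alpha> = n \<and> (\<forall>j. ?l j \<le> 1) then of_nat (?l i) else 0)"
      proof (cases "?l i = 1")
        case False
        moreover have "?l i \<noteq> 0" using i by (simp add: in_keys_iff)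
        ultimately have "\<not> ?l i \<le> 1" by linarith
        then show ?thesis using False by auto
      next
        case one: True
        have "?l j \<le> 1" for j using True one by (cases "j = i") auto
        then show ?thesis using True one by auto
      qed
      finally show ?thesis .
    next
      case False
      then have "\<not> (mdeg \<alpha> = n \<and> (\<forall>j. ?l j \<le> 1))" by blast
      then show ?thesis using False
        by (simp only: if_False simp_thms conj_assoc[symmetric] mult_zero_right sum.neutral_const)
    qed
  qed
  also have "\<dots> = (if mdeg \<alpha> = n \<and> (\<forall>j. ?l j \<le> 1) then of_nat n else 0)"
  proof (cases "mdeg \<alpha> = n \<and> (\<forall>j. ?l j \<le> 1)")
    case True
    then show ?thesis by (simp only: simp_thms if_True) (simp flip: of_nat_sum add: mdeg_def)
  qed (simp only: if_False sum.neutral_const)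
  also have "\<dots> = mcoeff (of_nat n * (elementary n :: 'a symfun)) \<alpha>"
    by (simp add: of_nat_mult_symfun scale.rep_eq elementary.rep_eq)
  finally show "mcoeff (of_nat n * (elementary n :: 'a symfun)) \<alpha> =
    mcoeff (\<Sum>k = 1..n. (-1) ^ (k - 1) * (power_sum k * elementary (n - k))) \<alpha>" by simp
qed

section \<open>The recursion for the elementary symmetric functions\<close>

text \<open>The operator z d/dz, which multiplies the coefficient of z^n by n without shifting the
  index.\<close>

definition euler_deriv :: "'a::comm_ring_1 fps \<Rightarrow> 'a fps" where
  "euler_deriv F = fps_X * fps_deriv F"

lemma euler_deriv_nth: "fps_nth (euler_deriv F) n = of_nat n * fps_nth F n"
  by (cases n) (simp_all add: euler_deriv_def)

lemma euler_deriv_mult: "euler_deriv (F * G) = euler_deriv F * G + F * euler_deriv G"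
  by (simp add: euler_deriv_def algebra_simps)

lemma euler_deriv_power_Suc:
  "euler_deriv (F ^ Suc n) = of_nat (Suc n) * (F ^ n * euler_deriv F)"
  by (simp only: euler_deriv_def fps_deriv_power' diff_Suc_1 mult_ac)

lemma fps_mult_nth_if_nth_0:
  fixes F G :: "'a::comm_ring_1 fps"
  assumes "fps_nth F 0 = 0"
  shows "fps_nth (F * G) n = (\<Sum>k = 1..n. fps_nth F k * fps_nth G (n - k))"
  by (simp add: fps_mult_nth sum.atLeast_Suc_atMost assms)

section \<open>Exponential series and first-order differential equations\<close>

lemma exp_fps_nth_0: "fps_nth (exp_fps F) 0 = 1"
  by (simp add: exp_fps_def)

text \<open>Termwise differentiation of the exponential series. As \<open>F\<close> has no constant
  term, only finitely many powers reach a given coefficient.\<close>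

lemma euler_deriv_exp_fps:
  fixes F :: "'a::field_char_0 symfun fps"
  assumes F0: "fps_nth F 0 = 0"
  shows "euler_deriv (exp_fps F) = euler_deriv F * exp_fps F"
proof (rule fps_ext)
  fix n
  let ?a = "\<lambda>i. (1 / of_nat (fact i)) \<odot> (1 :: 'a symfun)"
  have D0: "fps_nth (euler_deriv F) 0 = 0" by (simp add: euler_deriv_nth)
  have a_Suc: "of_nat (Suc i) * ?a (Suc i) = ?a i" for i
  proof -
    have "of_nat (Suc i) * (1 / of_nat (fact (Suc i))) = (1 / of_nat (fact i) :: 'a)"
      unfolding fact_Suc of_nat_mult of_nat_id using of_nat_neq_0[of i, where 'a = 'a] by simp
    then show ?thesis by (simp only: of_nat_mult_symfun symfun_vs.scale_scale)
  qed
  \<comment> \<open>The cut-off \<open>m\<close> is free above \<open>j\<close>, so coefficients of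
    different degrees can share one range of summation.\<close>
  have exp_nth: "fps_nth (exp_fps F) j = (\<Sum>i<m. ?a i * fps_nth (F ^ i) j)" if "j < m" for j m
  proof -
    have "fps_nth (exp_fps F) j = (\<Sum>i\<in>{0..j}. ?a i * fps_nth (F ^ i) j)"
      by (simp add: exp_fps_def fps_compose_nth)
    also have "\<dots> = (\<Sum>i<m. ?a i * fps_nth (F ^ i) j)"
      using that startsby_zero_power_prefix[OF F0] by (intro sum.mono_neutral_left) auto
    finally show ?thesis .
  qed
  have "fps_nth (euler_deriv (exp_fps F)) n
      = (\<Sum>i<Suc n. ?a i * fps_nth (euler_deriv (F ^ i)) n)"
    by (simp only: euler_deriv_nth exp_nth[OF lessI] sum_distrib_left mult_ac)
  also have "\<dots> = (\<Sum>i<n. ?a (Suc i) * fps_nth (euler_deriv (F ^ Suc i)) n)"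
    by (subst sum.lessThan_Suc_shift) (simp add: euler_deriv_def)
  also have "\<dots> = (\<Sum>i<n. ?a i * fps_nth (euler_deriv F * F ^ i) n)"
  proof (rule sum.cong[OF refl])
    fix i
    have "?a (Suc i) * fps_nth (euler_deriv (F ^ Suc i)) n
        = (of_nat (Suc i) * ?a (Suc i)) * fps_nth (euler_deriv F * F ^ i) n"
      unfolding euler_deriv_power_Suc fps_of_nat[symmetric] fps_mult_left_const_nth
      by (simp only: mult_ac)
    then show "?a (Suc i) * fps_nth (euler_deriv (F ^ Suc i)) n = ?a i * fps_nth (euler_deriv F * F ^ i) n"
      by (simp only: a_Suc)
  qed
  also have "\<dots> = (\<Sum>k = 1..n. fps_nth (euler_deriv F) k * (\<Sum>i<n. ?a i * fps_nth (F ^ i) (n - k)))"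
    unfolding fps_mult_nth_if_nth_0[OF D0] sum_distrib_left
    by (subst sum.swap) (simp only: mult_ac)
  \<comment> \<open>Here \<open>k \<ge> 1\<close>, so \<open>n - k < n\<close> and the cut-off
    \<open>n\<close> still captures the whole coefficient.\<close>
  also have "\<dots> = fps_nth (euler_deriv F * exp_fps F) n"
    unfolding fps_mult_nth_if_nth_0[OF D0]
    by (intro sum.cong refl) (auto simp: exp_nth[of "n - _" n])
  finally show "fps_nth (euler_deriv (exp_fps F)) n = fps_nth (euler_deriv F * exp_fps F) n" .
qed

lemma of_nat_mult_symfun_cancel:
  fixes f g :: "'a::field_char_0 symfun"
  shows "of_nat n * f = of_nat n * g \<Longrightarrow> 0 < n \<Longrightarrow> f = g"
  by (simp add: of_nat_mult_symfun)

text \<open>As \<open>H\<close> has no constant term, the equation expresses \<open>n\<close> times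
  the coefficient of degree \<open>n\<close> by lower ones; dividing by \<open>n\<close> leaves only
  the constant term free.\<close>

lemma euler_deriv_unique:
  fixes F G H :: "'a::field_char_0 symfun fps"
  assumes H0: "fps_nth H 0 = 0"
    and F: "euler_deriv F = H * F" and G: "euler_deriv G = H * G"
    and FG0: "fps_nth F 0 = fps_nth G 0"
  shows "F = G"
proof (rule fps_ext)
  fix n
  show "fps_nth F n = fps_nth G n"
  proof (induction n rule: less_induct)
    case (less n)
    show ?case
    proof (cases "n = 0")
      case False
      have "of_nat n * fps_nth F n = (\<Sum>k = 1..n. fps_nth H k * fps_nth F (n - k))"
        using arg_cong[OF F, of "\<lambda>F. fps_nth F n"]
        by (simp only: euler_deriv_nth fps_mult_nth_if_nth_0[OF H0])
      also have "\<dots> = (\<Sum>k = 1..n. fps_nth H k * fps_nth G (n - k))"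
        using less False by (intro sum.cong) auto
      also have "\<dots> = of_nat n * fps_nth G n"
        using arg_cong[OF G, of "\<lambda>F. fps_nth F n"]
        by (simp only: euler_deriv_nth fps_mult_nth_if_nth_0[OF H0])
      finally show ?thesis by (rule of_nat_mult_symfun_cancel) (use False in simp)
    qed (use FG0 in simp)
  qed
qed

section \<open>Generating functions and their differential equations\<close>

definition power_sum_fps :: "'a::field \<Rightarrow> 'a symfun fps" where
  "power_sum_fps c = Abs_fps (\<lambda>n. if n = 0 then 0 else c ^ n \<odot> power_sum n)"

text \<open>Here and in \<open>power_sum_fps\<close> the parameter \<open>c\<close> stands for the
  substitution of c z for z; the values \<open>1\<close> and \<open>t_var\<close> are the ones
  compared.\<close>

definition signed_elementary_fps :: "'a::field \<Rightarrow> 'a symfun fps" where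
  "signed_elementary_fps c = Abs_fps (\<lambda>n. c ^ n \<odot> ((-1) ^ n * elementary n))"

definition gen_complete_fps :: "ratfun symfun fps" where
  "gen_complete_fps = Abs_fps gen_complete"

text \<open>Newton's identity in generating function form.\<close>

lemma euler_deriv_signed_elementary_fps:
  "euler_deriv (signed_elementary_fps c) = - power_sum_fps c * signed_elementary_fps c"
proof (rule fps_ext)
  fix n
  have "fps_nth (euler_deriv (signed_elementary_fps c)) n
      = c ^ n \<odot> ((-1) ^ n * (of_nat n * elementary n))"
    by (simp add: euler_deriv_nth signed_elementary_fps_def scale_mult_right mult_ac)
  also have "\<dots> = (\<Sum>k = 1..n. c ^ n \<odot> (- ((-1) ^ (n - k) * (power_sum k * elementary (n - k)))))"
    unfolding newton_identity sum_distrib_left symfun_vs.scale_sum_right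
  proof (rule sum.cong[OF refl])
    fix k assume k: "k \<in> {1..n}"
    then obtain l where n: "n = l + k" by (metis atLeastAtMost_iff add.commute le_Suc_ex)
    obtain j where j: "k = Suc j" using k by (cases k) auto
    \<comment> \<open>The sign is split so that \<open>(-1) ^ (n - k)\<close> goes with
      \<open>elementary (n - k)\<close> and a single minus remains.\<close>
    have "(-1) ^ n * (-1) ^ (k - 1) = (- ((-1) ^ (n - k)) :: 'a symfun)"
      by (simp add: n j power_add mult.assoc flip: power_mult_distrib)
    then have "(-1) ^ n * ((-1) ^ (k - 1) * x) = - ((-1) ^ (n - k) * x)" for x :: "'a symfun"
      by (simp flip: mult.assoc)
    then show "c ^ n \<odot> ((-1) ^ n * ((-1) ^ (k - 1) * (power_sum k * elementary (n - k))))
      = c ^ n \<odot> (- ((-1) ^ (n - k) * (power_sum k * elementary (n - k))))" by simp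
  qed
  also have "\<dots> = fps_nth (- power_sum_fps c * signed_elementary_fps c) n"
    by (subst fps_mult_nth_if_nth_0)
      (auto simp: power_sum_fps_def signed_elementary_fps_def scale_mult_left scale_mult_right
        mult_ac simp flip: power_add intro!: sum.cong)
  finally show "fps_nth (euler_deriv (signed_elementary_fps c)) n
      = fps_nth (- power_sum_fps c * signed_elementary_fps c) n" .
qed

lemma elementary_0: "elementary 0 = 1"
proof (rule symfun_eqI)
  fix \<alpha> :: "nat \<Rightarrow>\<^sub>0 nat"
  have "mdeg \<alpha> = 0 \<longleftrightarrow> \<alpha> = 0"
    using lookup_le_mdeg[of \<alpha>] by (auto intro!: poly_mapping_eqI simp: mdeg_def)
  then show "mcoeff (elementary 0) \<alpha> = mcoeff 1 \<alpha>"
    by (auto simp: elementary.rep_eq one_symfun.rep_eq)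
qed

text \<open>The operator cancels the denominators \<open>n\<close> in the exponent, leaving the
  power sum series at z minus the one at t z.\<close>

lemma euler_deriv_gen_complete_fps:
  "euler_deriv gen_complete_fps = (power_sum_fps 1 - power_sum_fps t_var) * gen_complete_fps"
proof -
  let ?F = "Abs_fps (\<lambda>n. if n = 0 then 0 else ((1 - t_var ^ n) / of_nat n) \<odot> power_sum n)"
  have G: "gen_complete_fps = exp_fps ?F"
    by (rule fps_ext) (simp add: gen_complete_fps_def gen_complete_def)
  have "euler_deriv ?F = power_sum_fps 1 - power_sum_fps t_var"
    by (rule fps_ext)
      (auto simp: euler_deriv_nth power_sum_fps_def of_nat_mult_symfun symfun_vs.scale_left_diff_distrib)
  then show ?thesis unfolding G by (subst euler_deriv_exp_fps) auto
qed

lemma gen_complete_0: "gen_complete 0 = 1"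
  by (simp add: gen_complete_def exp_fps_nth_0)

text \<open>In the product rule the terms with \<open>power_sum_fps 1\<close> cancel, so both sides
  solve the same equation with constant term 1.\<close>

lemma signed_elementary_fps_t_var:
  "signed_elementary_fps t_var = gen_complete_fps * signed_elementary_fps 1"
proof (rule euler_deriv_unique)
  show "euler_deriv (gen_complete_fps * signed_elementary_fps 1)
      = - power_sum_fps t_var * (gen_complete_fps * signed_elementary_fps 1)"
    unfolding euler_deriv_mult euler_deriv_gen_complete_fps euler_deriv_signed_elementary_fps
    by (simp add: algebra_simps)
  show "euler_deriv (signed_elementary_fps t_var) = - power_sum_fps t_var * signed_elementary_fps t_var"
    by (rule euler_deriv_signed_elementary_fps)
qed (simp_all add: power_sum_fps_def signed_elementary_fps_def gen_complete_fps_def elementary_0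
      gen_complete_0)

text \<open>As \<open>t_var\<close> is an indeterminate, evaluation at 0 separates its powers from
  1. The divisions by \<open>t_var ^ m - 1\<close> rest on this.\<close>

lemma t_var_power_neq_1: "0 < n \<Longrightarrow> t_var ^ n \<noteq> 1"
proof
  assume n: "0 < n" and "t_var ^ n = 1"
  moreover have "t_var ^ n = Fract ([:0, 1:] ^ n) 1"
    by (induction n) (simp_all add: t_var_def One_fract_def)
  ultimately have "[:0, 1:] ^ n = (1 :: complex poly)"
    by (simp add: One_fract_def eq_fract)
  then have "poly ([:0, 1:] ^ n) 0 = (1 :: complex)" by simp
  with n show False by (simp add: power_0_left)
qed

lemma signed_elementary_rec:
  assumes "0 < m"
  shows "(-1) ^ m * elementary m =
    (\<Sum>j = 1..m. (1 / (t_var ^ m - 1)) \<odot> (gen_complete j * ((-1) ^ (m - j) * elementary (m - j))))"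
proof -
  let ?\<epsilon> = "\<lambda>n. (-1) ^ n * elementary n :: ratfun symfun"
  have "t_var ^ m \<odot> ?\<epsilon> m = (\<Sum>j = 0..m. gen_complete j * ?\<epsilon> (m - j))"
    using arg_cong[OF signed_elementary_fps_t_var, of "\<lambda>F. fps_nth F m"]
    by (simp add: fps_mult_nth gen_complete_fps_def signed_elementary_fps_def)
  \<comment> \<open>The summand \<open>j = 0\<close> is the unknown itself; moving it to the left
    produces the factor \<open>t_var ^ m - 1\<close>.\<close>
  also have "\<dots> = ?\<epsilon> m + (\<Sum>j = 1..m. gen_complete j * ?\<epsilon> (m - j))"
    by (simp add: sum.atLeast_Suc_atMost gen_complete_0)
  finally have "(t_var ^ m - 1) \<odot> ?\<epsilon> m = (\<Sum>j = 1..m. gen_complete j * ?\<epsilon> (m - j))"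
    by (simp add: symfun_vs.scale_left_diff_distrib)
  then have "(1 / (t_var ^ m - 1)) \<odot> ((t_var ^ m - 1) \<odot> ?\<epsilon> m)
      = (\<Sum>j = 1..m. (1 / (t_var ^ m - 1)) \<odot> (gen_complete j * ?\<epsilon> (m - j)))"
    by (simp add: symfun_vs.scale_sum_right)
  then show ?thesis using t_var_power_neq_1[OF assms] by simp
qed

section \<open>Expansion over brick tabloids\<close>

definition brick_weight :: "nat list \<Rightarrow> ratfun" where
  "brick_weight \<bb> = (\<Prod>i = 1..length \<bb>. 1 / (t_var ^ brick_end \<bb> i - 1))"

text \<open>Brick tabloids of \<open>m\<close> of every type, since the recursion does not fix the
  type.\<close>

definition bricks :: "nat \<Rightarrow> nat list set" where
  "bricks m = {\<bb>. (\<forall>b\<in>set \<bb>. 0 < b) \<and> sum_list \<bb> = m}"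

text \<open>Appending on the right keeps the earlier ends and adds the total length as a new one;
  this is why the recursion removes the last brick.\<close>

lemma brick_weight_snoc:
  "brick_weight (\<bb> @ [j]) = brick_weight \<bb> * (1 / (t_var ^ (sum_list \<bb> + j) - 1))"
proof -
  have "brick_end (\<bb> @ [j]) i = brick_end \<bb> i" if "i \<le> length \<bb>" for i
    using that by (simp add: brick_end_def)
  then show ?thesis by (simp add: brick_weight_def brick_end_def[of "\<bb> @ [j]" "Suc (length \<bb>)"])
qed

lemma gen_complete_part_append:
  "gen_complete_part (\<rho> @ \<sigma>) = gen_complete_part \<rho> * gen_complete_part \<sigma>"
  by (simp add: gen_complete_part_def)

lemma gen_complete_part_single: "gen_complete_part [n] = gen_complete n"
  by (simp add: gen_complete_part_def)

lemma sum_list_sort: "sum_list (sort xs) = sum_list xs"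
  for xs :: "nat list"
  by (metis mset_sort sum_mset_sum_list)

lemma brick_tabloids_iff:
  "\<rho> \<in> partitions m \<Longrightarrow> \<bb> \<in> brick_tabloids \<rho> \<longleftrightarrow> \<bb> \<in> bricks m \<and> rev (sort \<bb>) = \<rho>"
  by (auto simp: brick_tabloids_def bricks_def partitions_def sum_list_sort)

lemma rev_sort_in_partitions: "\<bb> \<in> bricks m \<Longrightarrow> rev (sort \<bb>) \<in> partitions m"
  by (auto simp: bricks_def partitions_def sorted_wrt_rev sum_list_sort)

lemma finite_bricks: "finite (bricks m)"
proof (rule finite_subset)
  show "bricks m \<subseteq> (\<Union>\<rho>\<in>partitions m. brick_tabloids \<rho>)"
    using rev_sort_in_partitions by (auto simp: brick_tabloids_iff)
  show "finite (\<Union>\<rho>\<in>partitions m. brick_tabloids \<rho>)"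
    by (simp add: finite_partitions finite_brick_tabloids)
qed

lemma gen_complete_part_mset: "mset \<rho> = mset \<sigma> \<Longrightarrow> gen_complete_part \<rho> = gen_complete_part \<sigma>"
  unfolding gen_complete_part_def by (simp flip: prod_mset_prod_list)

lemma signed_elementary_bricks:
  "(-1) ^ m * elementary m = (\<Sum>\<bb>\<in>bricks m. brick_weight \<bb> \<odot> gen_complete_part \<bb>)"
proof (induction m rule: less_induct)
  case (less m)
  show ?case
  proof (cases "m = 0")
    case True
    have "\<bb> = []" if "\<bb> \<in> bricks 0" for \<bb>
      using that by (cases \<bb>) (auto simp: bricks_def)
    then have "bricks 0 = {[]}" by (auto simp: bricks_def)
    then show ?thesis
      using True by (simp add: elementary_0 brick_weight_def gen_complete_part_def)
  next
    case False
    let ?c = "1 / (t_var ^ m - 1)"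
    have "(-1) ^ m * elementary m = (\<Sum>j = 1..m. ?c \<odot>
        (gen_complete j * (\<Sum>\<bb>\<in>bricks (m - j). brick_weight \<bb> \<odot> gen_complete_part \<bb>)))"
      using False less by (subst signed_elementary_rec) (auto intro!: sum.cong)
    \<comment> \<open>The bricks before it fill \<open>m - j\<close>, so the appended brick ends at
      \<open>m\<close> and \<open>?c\<close> is exactly its factor.\<close>
    also have "\<dots> = (\<Sum>j = 1..m. \<Sum>\<bb>\<in>bricks (m - j).
        brick_weight (\<bb> @ [j]) \<odot> gen_complete_part (\<bb> @ [j]))"
      by (auto simp: sum_distrib_left symfun_vs.scale_sum_right brick_weight_snoc bricks_def
          gen_complete_part_append gen_complete_part_single scale_mult_right mult_ac intro!: sum.cong)
    also have "\<dots> = (\<Sum>(j, \<bb>)\<in>(SIGMA j:{1..m}. bricks (m - j)).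
        brick_weight (\<bb> @ [j]) \<odot> gen_complete_part (\<bb> @ [j]))"
      by (rule sum.Sigma) (auto simp: finite_bricks)
    also have "\<dots> = (\<Sum>\<bb>\<in>bricks m. brick_weight \<bb> \<odot> gen_complete_part \<bb>)"
    proof (rule sum.reindex_bij_witness
        [where j = "\<lambda>(j, \<bb>). \<bb> @ [j]" and i = "\<lambda>\<bb>. (last \<bb>, butlast \<bb>)"])
      fix \<bb> assume b: "\<bb> \<in> bricks m"
      with False have "\<bb> \<noteq> []" by (auto simp: bricks_def)
      then obtain \<bb>' j where "\<bb> = \<bb>' @ [j]" by (cases \<bb> rule: rev_cases) auto
      with b show "(last \<bb>, butlast \<bb>) \<in> (SIGMA j:{1..m}. bricks (m - j))"
        and "(case (last \<bb>, butlast \<bb>) of (j, \<bb>) \<Rightarrow> \<bb> @ [j]) = \<bb>"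
        by (auto simp: bricks_def)
    qed (auto simp: bricks_def)
    finally show ?thesis .
  qed
qed

text \<open>Tabloids are grouped by type: rearranging the bricks changes the weight but not the
  product of the \<open>gen_complete\<close> factors.\<close>

lemma elementary_expansion:
  "elementary m = (\<Sum>\<rho>\<in>partitions m.
    ((-1) ^ m * (\<Sum>\<bb>\<in>brick_tabloids \<rho>. brick_weight \<bb>)) \<odot> gen_complete_part \<rho>)"
proof -
  have "(\<Sum>\<bb>\<in>bricks m. brick_weight \<bb> \<odot> gen_complete_part \<bb>)
      = (\<Sum>\<rho>\<in>partitions m. \<Sum>\<bb>\<in>{\<bb>\<in>bricks m. rev (sort \<bb>) = \<rho>}. brick_weight \<bb> \<odot> gen_complete_part \<bb>)"
    by (rule sum.group[symmetric]) (auto simp: finite_bricks finite_partitions rev_sort_in_partitions)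
  also have "\<dots> = (\<Sum>\<rho>\<in>partitions m. \<Sum>\<bb>\<in>brick_tabloids \<rho>. brick_weight \<bb> \<odot> gen_complete_part \<rho>)"
    by (intro sum.cong) (auto simp: brick_tabloids_iff intro!: arg_cong2[of _ _ _ _ scale] gen_complete_part_mset)
  finally have "(-1) ^ m * ((-1) ^ m * elementary m)
      = (\<Sum>\<rho>\<in>partitions m. ((-1) ^ m * (\<Sum>\<bb>\<in>brick_tabloids \<rho>. brick_weight \<bb>)) \<odot> gen_complete_part \<rho>)"
    unfolding signed_elementary_bricks
    by (simp add: neg_one_power_mult_symfun symfun_vs.scale_sum_right symfun_vs.scale_sum_left sum_distrib_left)
  then show ?thesis by (simp flip: mult.assoc power_mult_distrib)
qed

section \<open>Linear independence\<close>

definition power_sum_part :: "nat list \<Rightarrow> 'a::comm_ring_1 symfun" where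
  "power_sum_part \<rho> = prod_list (map power_sum \<rho>)"

text \<open>The monomial arising in a product of power sums when the factor for
  \<open>\<sigma> ! j\<close> contributes the variable \<open>is ! j\<close>; exponents add up when
  variables repeat.\<close>

definition monom_of :: "nat list \<Rightarrow> nat list \<Rightarrow> (nat \<Rightarrow>\<^sub>0 nat)" where
  "monom_of is \<sigma> = sum_list (map2 Poly_Mapping.single is \<sigma>)"

text \<open>The coefficient counts choices of one variable per factor. The natural number
  \<open>k\<close> records that nothing cancels, whereas nonzero terms of a ring may sum to
  zero.\<close>

lemma mcoeff_power_sum_part:
  assumes "\<forall>b\<in>set \<sigma>. 0 < b"
  shows "\<exists>k. mcoeff (power_sum_part \<sigma> :: 'a::comm_ring_1 symfun) \<alpha> = of_nat k \<and>
    (k \<noteq> 0 \<longleftrightarrow> (\<exists>is. length is = length \<sigma> \<and> \<alpha> = monom_of is \<sigma>))"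
  using assms
proof (induction \<sigma> arbitrary: \<alpha>)
  case Nil
  show ?case
    by (rule exI[of _ "if \<alpha> = 0 then 1 else 0"])
      (simp add: power_sum_part_def one_symfun.rep_eq monom_of_def)
next
  case (Cons n \<sigma>)
  let ?I = "{i. n \<le> Poly_Mapping.lookup \<alpha> i}"
  from Cons have "\<exists>k. \<forall>\<beta>. mcoeff (power_sum_part \<sigma> :: 'a symfun) \<beta> = of_nat (k \<beta>) \<and>
      (k \<beta> \<noteq> 0 \<longleftrightarrow> (\<exists>is. length is = length \<sigma> \<and> \<beta> = monom_of is \<sigma>))"
    by (intro choice) auto
  then obtain k where
    k: "\<And>\<beta>. mcoeff (power_sum_part \<sigma> :: 'a symfun) \<beta> = of_nat (k \<beta>)"
      "\<And>\<beta>. k \<beta> \<noteq> 0 \<longleftrightarrow> (\<exists>is. length is = length \<sigma> \<and> \<beta> = monom_of is \<sigma>)"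
    by blast
  have n: "0 < n" using Cons.prems by simp
  let ?K = "\<Sum>i\<in>?I. k (\<alpha> - Poly_Mapping.single i n)"
  have "mcoeff (power_sum_part (n # \<sigma>) :: 'a symfun) \<alpha> = of_nat ?K"
    using mcoeff_power_sum_mult[OF n, of "power_sum_part \<sigma>" \<alpha>]
    by (simp add: power_sum_part_def flip: k(1))
  moreover have "?K \<noteq> 0 \<longleftrightarrow> (\<exists>i\<in>?I. \<exists>is. length is = length \<sigma> \<and>
      \<alpha> - Poly_Mapping.single i n = monom_of is \<sigma>)"
    using finite_le_lookup[OF n] k(2) by auto
  moreover have "\<dots> \<longleftrightarrow> (\<exists>is. length is = length (n # \<sigma>) \<and> \<alpha> = monom_of is (n # \<sigma>))"
  proof
    assume "\<exists>i\<in>?I. \<exists>is. length is = length \<sigma> \<and> \<alpha> - Poly_Mapping.single i n = monom_of is \<sigma>"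
    then obtain i "is" where *: "n \<le> Poly_Mapping.lookup \<alpha> i" "length is = length \<sigma>"
      "\<alpha> - Poly_Mapping.single i n = monom_of is \<sigma>" by auto
    then have "\<alpha> = Poly_Mapping.single i n + monom_of is \<sigma>" using single_add_diff[OF *(1)] by simp
    then show "\<exists>is. length is = length (n # \<sigma>) \<and> \<alpha> = monom_of is (n # \<sigma>)"
      using * by (intro exI[of _ "i # is"]) (simp add: monom_of_def)
  next
    assume "\<exists>is. length is = length (n # \<sigma>) \<and> \<alpha> = monom_of is (n # \<sigma>)"
    then obtain i "is" where "length is = length \<sigma>" "\<alpha> = Poly_Mapping.single i n + monom_of is \<sigma>"
      by (auto simp: monom_of_def length_Suc_conv)
    then show "\<exists>i\<in>?I. \<exists>is. length is = length \<sigma> \<and> \<alpha> - Poly_Mapping.single i n = monom_of is \<sigma>"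
      by (intro bexI[of _ i] exI[of _ "is"]) (auto simp: lookup_add)
  qed
  ultimately show ?case by blast
qed

lemma lookup_monom_of:
  "length is = length \<sigma> \<Longrightarrow>
    Poly_Mapping.lookup (monom_of is \<sigma>) i = (\<Sum>j<length is. if is ! j = i then \<sigma> ! j else 0)"
  by (induction "is" \<sigma> rule: list_induct2)
    (auto simp: monom_of_def lookup_add lookup_single when_def sum.lessThan_Suc_shift
      simp del: sum.lessThan_Suc intro!: sum.cong)

lemma partitions_eqI_mset:
  assumes "\<rho> \<in> partitions m" "\<sigma> \<in> partitions m" "mset \<rho> = mset \<sigma>"
  shows "\<rho> = \<sigma>"
proof -
  have "sort \<rho> = rev \<rho>" "sort \<rho> = rev \<sigma>"
    using assms by (auto intro!: properties_for_sort simp: partitions_def sorted_wrt_rev)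
  then show ?thesis by simp
qed

text \<open>
  Each variable of \<open>x\<^sub>0\<^bsup>\<rho>\<^sub>0\<^esup> x\<^sub>1\<^bsup>\<rho>\<^sub>1\<^esup> \<dots>\<close> must be hit by a factor of \<open>p\<^sub>\<sigma>\<close>, so \<open>\<sigma>\<close> refines \<open>\<rho>\<close>.
\<close>

lemma monom_of_upt_eq_imp:
  assumes \<rho>: "\<rho> \<in> partitions m" and \<sigma>: "\<sigma> \<in> partitions m" and len: "length is = length \<sigma>"
    and eq: "monom_of [0..<length \<rho>] \<rho> = monom_of is \<sigma>"
  shows "length \<rho> < length \<sigma> \<or> \<rho> = \<sigma>"
proof -
  have l: "Poly_Mapping.lookup (monom_of is \<sigma>) i = (if i < length \<rho> then \<rho> ! i else 0)" for i
    unfolding eq[symmetric] by (subst lookup_monom_of) (auto cong: sum.cong_simp)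
  have sub: "{..<length \<rho>} \<subseteq> set is"
  proof
    fix i assume "i \<in> {..<length \<rho>}"
    then have "(\<Sum>j<length is. if is ! j = i then \<sigma> ! j else 0) \<noteq> 0"
      using l[of i] \<rho> by (simp add: lookup_monom_of[OF len] partitions_def del: sum_eq_0_iff)
    then show "i \<in> set is" by (auto split: if_splits)
  qed
  have le: "length \<rho> \<le> length \<sigma>"
    using card_mono[OF _ sub] card_length[of "is"] len by simp
  show ?thesis
  proof (cases "length \<rho> = length \<sigma>")
    case True
    \<comment> \<open>With equal lengths, \<open>is\<close> covers the variables without repetition,
      so \<sigma> is a rearrangement of \<rho>.\<close>
    have card: "card (set is) = length is"
      using card_mono[OF _ sub] card_length[of "is"] len True by simp
    then have dist: "distinct is" by (rule card_distinct)
    have set: "set is = {..<length \<rho>}"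
      using card_subset_eq[OF _ sub] card len True by simp
    have "\<sigma> ! j = \<rho> ! (is ! j)" if j: "j < length is" for j
    proof -
      have "is ! j < length \<rho>" using set nth_mem[OF j] by auto
      then have "\<rho> ! (is ! j) = (\<Sum>k<length is. if is ! k = is ! j then \<sigma> ! k else 0)"
        using l[of "is ! j"] by (simp add: lookup_monom_of[OF len])
      also have "\<dots> = (\<Sum>k<length is. if k = j then \<sigma> ! k else 0)"
        using dist j by (intro sum.cong) (auto simp: nth_eq_iff_index_eq)
      also have "\<dots> = \<sigma> ! j" using j by simp
      finally show ?thesis by simp
    qed
    then have "\<sigma> = map ((!) \<rho>) is" using len by (intro nth_equalityI) auto
    moreover have "mset is = mset [0..<length \<rho>]"
      using dist set set_eq_iff_mset_eq_distinct[of "is" "[0..<length \<rho>]"]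
      by (simp add: lessThan_atLeast0)
    ultimately have "mset \<sigma> = mset (map ((!) \<rho>) [0..<length \<rho>])" by simp
    then show ?thesis using partitions_eqI_mset[OF \<rho> \<sigma>] by (simp add: map_nth)
  qed (use le in simp)
qed

text \<open>Triangularity: a longest \<rho> with nonzero scalar is chosen and the coefficient of its
  monomial is examined. Any other \<sigma> contributing there would be longer.\<close>

lemma power_sum_part_independent:
  fixes c :: "nat list \<Rightarrow> 'a::field_char_0"
  assumes 0: "(\<Sum>\<rho>\<in>partitions m. c \<rho> \<odot> power_sum_part \<rho>) = 0"
  shows "\<forall>\<rho>\<in>partitions m. c \<rho> = 0"
proof (rule ccontr)
  let ?S = "{\<rho>\<in>partitions m. c \<rho> \<noteq> 0}"
  assume "\<not> (\<forall>\<rho>\<in>partitions m. c \<rho> = 0)"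
  then have S: "?S \<noteq> {}" "finite ?S" using finite_partitions by auto
  then have "Max (length ` ?S) \<in> length ` ?S" by (intro Max_in) auto
  then obtain \<rho> where \<rho>: "\<rho> \<in> ?S" and "Max (length ` ?S) = length \<rho>" by blast
  then have max: "length \<sigma> \<le> length \<rho>" if "\<sigma> \<in> ?S" for \<sigma>
    using that S Max_ge[of "length ` ?S" "length \<sigma>"] by simp
  let ?\<alpha> = "monom_of [0..<length \<rho>] \<rho>"
  have pos: "\<forall>b\<in>set \<sigma>. 0 < b" if "\<sigma> \<in> partitions m" for \<sigma>
    using that by (simp add: partitions_def)
  have vanish: "c \<sigma> * mcoeff (power_sum_part \<sigma>) ?\<alpha> = 0" if "\<sigma> \<in> partitions m - {\<rho>}" for \<sigma>
  proof (rule ccontr)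
    assume *: "c \<sigma> * mcoeff (power_sum_part \<sigma>) ?\<alpha> \<noteq> 0"
    have \<sigma>: "\<sigma> \<in> partitions m" using that by simp
    obtain k where k: "mcoeff (power_sum_part \<sigma> :: 'a symfun) ?\<alpha> = of_nat k"
      "k \<noteq> 0 \<longleftrightarrow> (\<exists>is. length is = length \<sigma> \<and> ?\<alpha> = monom_of is \<sigma>)"
      using mcoeff_power_sum_part[OF pos[OF \<sigma>]] by blast
    have "k \<noteq> 0" using * k(1) by auto
    then obtain "is" where "length is = length \<sigma>" "?\<alpha> = monom_of is \<sigma>"
      using k(2) by blast
    then have "length \<rho> < length \<sigma>" using monom_of_upt_eq_imp[of \<rho> m \<sigma> "is"] \<rho> that by auto
    then show False using max[of \<sigma>] * that by auto
  qed
  have "0 = (\<Sum>\<sigma>\<in>partitions m. c \<sigma> * mcoeff (power_sum_part \<sigma>) ?\<alpha>)"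
    using arg_cong[OF 0, of "\<lambda>f. mcoeff f ?\<alpha>"] by (simp add: mcoeff_sum mcoeff_simps)
  also have "\<dots> = (\<Sum>\<sigma>\<in>{\<rho>}. c \<sigma> * mcoeff (power_sum_part \<sigma>) ?\<alpha>)"
    using vanish \<rho> by (intro sum.mono_neutral_right finite_partitions ballI) blast+
  also have "\<dots> = c \<rho> * mcoeff (power_sum_part \<rho>) ?\<alpha>" by simp
  \<comment> \<open>Letting each factor take its own variable yields this monomial, so its
    coefficient is a positive integer, nonzero in characteristic zero.\<close>
  also have "\<dots> \<noteq> 0"
    using mcoeff_power_sum_part[OF pos, of \<rho> ?\<alpha>, where 'a = 'a] \<rho> by (auto intro: exI[of _ "[0..<length \<rho>]"])
  finally show False by simp
qed

section \<open>Power sums in the span of the generalized complete products\<close>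

definition gen_complete_span :: "nat \<Rightarrow> ratfun symfun set" where
  "gen_complete_span m = symfun_vs.span (gen_complete_part ` partitions m)"

lemma gen_complete_part_in_span: "\<bb> \<in> bricks m \<Longrightarrow> gen_complete_part \<bb> \<in> gen_complete_span m"
  unfolding gen_complete_span_def
  using rev_sort_in_partitions[of \<bb> m] gen_complete_part_mset[of \<bb> "rev (sort \<bb>)"]
  by (auto intro: symfun_vs.span_base)

lemma gen_complete_in_span: "gen_complete n \<in> gen_complete_span n"
proof (cases "n = 0")
  case True
  then show ?thesis
    using gen_complete_part_in_span[of "[]" 0] by (simp add: bricks_def gen_complete_part_def gen_complete_0)
next
  case False
  then show ?thesis
    using gen_complete_part_in_span[of "[n]" n] by (simp add: bricks_def gen_complete_part_single)
qed

text \<open>By bilinearity two generators suffice; their partitions concatenate, and sorting the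
  result does not change the product.\<close>

lemma gen_complete_span_mult:
  assumes "f \<in> gen_complete_span m" "g \<in> gen_complete_span n"
  shows "f * g \<in> gen_complete_span (m + n)"
proof -
  have part: "gen_complete_part \<rho> * g \<in> gen_complete_span (m + n)" if \<rho>: "\<rho> \<in> partitions m" for \<rho>
    using assms(2) unfolding gen_complete_span_def[of n]
  proof (induction g rule: symfun_vs.span_induct_alt)
    case base
    then show ?case by (simp add: gen_complete_span_def symfun_vs.span_zero)
  next
    case (step c x y)
    then obtain \<sigma> where \<sigma>: "\<sigma> \<in> partitions n" "x = gen_complete_part \<sigma>" by auto
    then have "gen_complete_part \<rho> * x \<in> gen_complete_span (m + n)"
      using gen_complete_part_in_span[of "\<rho> @ \<sigma>" "m + n"] \<rho>
      by (auto simp: gen_complete_part_append bricks_def partitions_def)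
    with step show ?case
      by (simp add: gen_complete_span_def distrib_left scale_mult_right symfun_vs.span_add symfun_vs.span_scale)
  qed
  show ?thesis using assms(1) unfolding gen_complete_span_def[of m]
  proof (induction f rule: symfun_vs.span_induct_alt)
    case base
    then show ?case by (simp add: gen_complete_span_def symfun_vs.span_zero)
  next
    case (step c x y)
    then have "x * g \<in> gen_complete_span (m + n)" using part by auto
    with step show ?case
      by (simp add: gen_complete_span_def distrib_right scale_mult_left symfun_vs.span_add symfun_vs.span_scale)
  qed
qed

text \<open>In the coefficient of z^n of the differential equation for
  \<open>gen_complete_fps\<close>, \<open>power_sum n\<close> occurs only in the last term, with the
  invertible factor \<open>1 - t_var ^ n\<close>; the other power sums are covered by
  induction.\<close>

lemma power_sum_in_span: "0 < n \<Longrightarrow> power_sum n \<in> gen_complete_span n"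
proof (induction n rule: less_induct)
  case (less n)
  let ?h = "\<lambda>k. (1 - t_var ^ k) \<odot> (power_sum k * gen_complete (n - k))"
  have "of_nat n \<odot> gen_complete n = (\<Sum>k = 1..n. ?h k)"
    using arg_cong[OF euler_deriv_gen_complete_fps, of "\<lambda>F. fps_nth F n"]
    by (subst (asm) fps_mult_nth_if_nth_0)
      (auto simp: euler_deriv_nth gen_complete_fps_def power_sum_fps_def of_nat_mult_symfun
        scale_mult_left left_diff_distrib symfun_vs.scale_left_diff_distrib)
  also have "\<dots> = ?h n + (\<Sum>k = 1..<n. ?h k)"
    using less.prems by (simp add: sum.last_plus)
  finally have "(1 - t_var ^ n) \<odot> power_sum n = of_nat n \<odot> gen_complete n - (\<Sum>k = 1..<n. ?h k)"
    by (simp add: gen_complete_0)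
  also have "\<dots> \<in> gen_complete_span n"
  proof -
    have "?h k \<in> gen_complete_span n" if "k \<in> {1..<n}" for k
      using gen_complete_span_mult[OF less.IH[of k] gen_complete_in_span[of "n - k"]] that
      by (simp add: gen_complete_span_def symfun_vs.span_scale)
    then have "(\<Sum>k = 1..<n. ?h k) \<in> gen_complete_span n"
      unfolding gen_complete_span_def by (rule symfun_vs.span_sum)
    then show ?thesis
      using gen_complete_in_span[of n] unfolding gen_complete_span_def
      by (intro symfun_vs.span_diff symfun_vs.span_scale)
  qed
  finally have "(1 / (1 - t_var ^ n)) \<odot> (1 - t_var ^ n) \<odot> power_sum n \<in> gen_complete_span n"
    unfolding gen_complete_span_def by (rule symfun_vs.span_scale)
  then show ?case using t_var_power_neq_1[OF less.prems] by simp
qed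

lemma power_sum_part_in_span:
  "\<forall>b\<in>set \<rho>. 0 < b \<Longrightarrow> power_sum_part \<rho> \<in> gen_complete_span (sum_list \<rho>)"
proof (induction \<rho>)
  case Nil
  then show ?case
    using gen_complete_in_span[of 0] by (simp add: power_sum_part_def gen_complete_0)
next
  case (Cons n \<rho>)
  then have "power_sum n * power_sum_part \<rho> \<in> gen_complete_span (n + sum_list \<rho>)"
    by (intro gen_complete_span_mult power_sum_in_span) auto
  then show ?case by (simp add: power_sum_part_def)
qed

lemma gen_complete_part_independent:
  assumes "(\<Sum>\<rho>\<in>partitions m. c \<rho> \<odot> gen_complete_part \<rho>) = 0" "\<rho> \<in> partitions m"
  shows "c \<rho> = 0"
proof (rule symfun_vs.scalars_zero_if_independent_in_span[OF finite_partitions _ _ assms])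
  show "power_sum_part ` partitions m \<subseteq> symfun_vs.span (gen_complete_part ` partitions m)"
    using power_sum_part_in_span by (auto simp: partitions_def gen_complete_span_def)
qed (rule power_sum_part_independent)

theorem corollary3p2:
  fixes m :: nat and \<rho> :: "nat list"
  assumes "\<rho> \<in> partitions m"
  shows "e_to_q_coeff m \<rho> = (-1) ^ m *
    (\<Sum>\<bb>\<in>brick_tabloids \<rho>. \<Prod>i = 1..length \<bb>. 1 / (t_var ^ brick_end \<bb> i - 1))"
proof -
  \<comment> \<open>The value 0 outside \<open>partitions m\<close> matches the normalization in
    \<open>e_to_q_coeff\<close>.\<close>
  define c where "c = (\<lambda>\<rho>. if \<rho> \<in> partitions m
    then (-1) ^ m * (\<Sum>\<bb>\<in>brick_tabloids \<rho>. brick_weight \<bb>) else 0)"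
  have c: "elementary m = (\<Sum>\<rho>\<in>partitions m. c \<rho> \<odot> gen_complete_part \<rho>)"
    using elementary_expansion by (simp add: c_def)
  have "e_to_q_coeff m = c"
    unfolding e_to_q_coeff_def
  proof (rule the_equality)
    fix d :: "nat list \<Rightarrow> ratfun"
    assume d: "(\<forall>\<rho>. \<rho> \<notin> partitions m \<longrightarrow> d \<rho> = 0) \<and>
      elementary m = (\<Sum>\<rho>\<in>partitions m. d \<rho> \<odot> gen_complete_part \<rho>)"
    then have "(\<Sum>\<rho>\<in>partitions m. (d \<rho> - c \<rho>) \<odot> gen_complete_part \<rho>) = 0"
      using c by (simp add: symfun_vs.scale_left_diff_distrib sum_subtractf)
    then have "d \<rho> - c \<rho> = 0" if "\<rho> \<in> partitions m" for \<rho>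
      using gen_complete_part_independent[of "\<lambda>\<rho>. d \<rho> - c \<rho>"] that by blast
    then show "d = c" using d by (auto simp: c_def fun_eq_iff)
  qed (use c in \<open>simp add: c_def\<close>)
  then show ?thesis using assms by (simp add: c_def brick_weight_def)
qed

end
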